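(* For every graded poset $P$, $$\Delta^{\mathrm{BQSym}}(F_B(P))=\sum_{\widehat 0<x\le\widehat 1}F_B([\widehat 0,x])\otimes F([x,\widehat 1]).$$
   Context: All graded posets are finite, with minimal element $\widehat 0$, maximal element $\widehat 1$ and rank function $\rho$; $\rho(x,y)=\rho(y)-\rho(x)$. $\mathrm{QSym}$ is the algebra (over a field $\mathbf{k}$) of quasisymmetric functions in $t_1,t_2,\ldots$, with linear basis $M_{(p_1,\ldots,p_k)}=\sum_{i_1<\cdots<i_k}t_{i_1}^{p_1}\cdots t_{i_k}^{p_k}$ (all $p_i\ge1$, $k\ge0$), and coproduct $\Delta^{\mathrm{QSym}}(M_{(p_1,\ldots,p_k)})=\sum_{i=0}^kM_{(p_1,\ldots,p_i)}\otimes M_{(p_{i+1},\ldots,p_k)}$, written $\Delta^{\mathrm{QSym}}(f)=\sum_f^{\mathrm{QSym}}f_{(1)}\otimes f_{(2)}$. The quasisymmetric function of $P$ is $F(P)=\lim_{m\to\infty}\sum_{\widehat 0=x_0\le x_1\le\cdots\le x_m=\widehat 1}t_1^{\rho(x_0,x_1)}\cdots t_m^{\rho(x_{m-1},x_m)}\in\mathrm{QSym}$; for the one-element poset it equals $1$. Let $\mathrm{BQSym}=\mathbf{k}[s]\otimes\mathrm{QSym}$. The type $B$ quasisymmetric function of $P$ is $F_B(P)=\sum_{\widehat 0<x\le\widehat 1}s^{\rho(x)-1}\cdot F([x,\widehat 1])\in\mathrm{BQSym}$. The linear map $\Delta^{\mathrm{BQSym}}:\mathrm{BQSym}\to\mathrm{BQSym}\otimes\mathrm{QSym}$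 is defined by $\Delta^{\mathrm{BQSym}}(s^p\cdot f)=\sum_f^{\mathrm{QSym}}s^p\cdot f_{(1)}\otimes f_{(2)}$ for $p\ge 0$, $f\in\mathrm{QSym}$. *)

theory Defs
  imports
    "HOL-Analysis.Function_Topology"
    "HOL-Computational_Algebra.Polynomial"
    "HOL-Library.Function_Algebras"
    "HOL-Library.Poly_Mapping"
begin

section \<open>Coefficient functions and tensor products\<close>

text \<open>
  All the spaces below are subspaces of function spaces \<open>'i \<Rightarrow> 'k\<close> over a field: a formal sum over
  a set of monomials \<open>'i\<close> is given by its coefficients. Addition is pointwise. (The pointwise
  product of \<open>Function_Algebras\<close> is not the product of series and is never used.)
\<close>

definition fscale :: "'k::field \<Rightarrow> ('i \<Rightarrow> 'k) \<Rightarrow> ('i \<Rightarrow> 'k)" where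
  "fscale c f = (\<lambda>i. c * f i)"

global_interpretation fs: vector_space "fscale :: 'k::field \<Rightarrow> ('i \<Rightarrow> 'k) \<Rightarrow> ('i \<Rightarrow> 'k)"
  by unfold_locales (auto simp: fscale_def fun_eq_iff algebra_simps)

global_interpretation fsp: vector_space_pair
  "fscale :: 'k::field \<Rightarrow> ('i \<Rightarrow> 'k) \<Rightarrow> ('i \<Rightarrow> 'k)"
  "fscale :: 'k::field \<Rightarrow> ('j \<Rightarrow> 'k) \<Rightarrow> ('j \<Rightarrow> 'k)"
  by unfold_locales

text \<open>
  The tensor product of \<open>V \<subseteq> 'i \<Rightarrow> 'k\<close> and \<open>W \<subseteq> 'j \<Rightarrow> 'k\<close> is realised inside \<open>'i \<times> 'j \<Rightarrow> 'k\<close>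
  (series in two independent sets of variables). Lemma \<open>tensor_independent\<close> below shows that
  the spanning set of \<open>tensor_space V W\<close> satisfies no relations besides the bilinear ones.
\<close>

definition tensor :: "('i \<Rightarrow> 'k::field) \<Rightarrow> ('j \<Rightarrow> 'k) \<Rightarrow> ('i \<times> 'j \<Rightarrow> 'k)"  (infixr \<open>\<otimes>\<close> 75) where
  "f \<otimes> g = (\<lambda>(i, j). f i * g j)"

definition tensor_space :: "('i \<Rightarrow> 'k::field) set \<Rightarrow> ('j \<Rightarrow> 'k) set \<Rightarrow> ('i \<times> 'j \<Rightarrow> 'k) set" where
  "tensor_space V W = fs.span {f \<otimes> g | f g. f \<in> V \<and> g \<in> W}"

text \<open>The canonical isomorphism from \<open>U \<otimes> (V \<otimes> W)\<close> to \<open>(U \<otimes> V) \<otimes> W\<close>.\<close>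

definition tensor_assoc :: "('i \<times> 'j \<times> 'l \<Rightarrow> 'k::field) \<Rightarrow> (('i \<times> 'j) \<times> 'l \<Rightarrow> 'k)" where
  "tensor_assoc h = (\<lambda>((i, j), l). h (i, j, l))"


section \<open>Quasisymmetric functions\<close>

text \<open>
  A monomial in \<open>t\<^sub>1, t\<^sub>2, \<dots>\<close> is given by its finitely supported exponent vector. The
  variables are numbered from 0, so the exponent of \<open>t\<^sub>i\<^sub>+\<^sub>1\<close> is the value at \<open>i\<close>.
\<close>

type_synonym mono = "nat \<Rightarrow>\<^sub>0 nat"
type_synonym 'k series = "mono \<Rightarrow> 'k"

definition mono_series :: "mono \<Rightarrow> 'k::field series" where
  "mono_series m = (\<lambda>m'. if m' = m then 1 else 0)"

definition compositions :: "nat list set" where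
  "compositions = {\<alpha>. \<forall>p\<in>set \<alpha>. 1 \<le> p}"

text \<open>
  \<open>M_QSym [p\<^sub>1, \<dots>, p\<^sub>k]\<close> is the sum, over all index sequences \<open>i\<^sub>1 < \<dots> < i\<^sub>k\<close>, of the monomial with
  exponent \<open>p\<^sub>j\<close> at \<open>i\<^sub>j\<close> for each \<open>j\<close>. The coefficient of \<open>m\<close> in this infinite sum is the number
  of index sequences whose summand is \<open>m\<close>.
\<close>

definition M_QSym :: "nat list \<Rightarrow> 'k::field series" where
  "M_QSym \<alpha> = (\<lambda>m. of_nat (card {is. sorted_wrt (<) is \<and> length is = length \<alpha> \<and>
            m = (\<Sum>j<length \<alpha>. Poly_Mapping.single (is ! j) (\<alpha> ! j))}))"

definition QSym :: "'k::field series set" where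
  "QSym = fs.span (M_QSym ` compositions)"

text \<open>
  The coproducts are extended linearly from the bases; see \<open>M_QSym_independent\<close>,
  \<open>BQSym_basis_independent\<close>, \<open>delta_QSym_M\<close> and \<open>delta_BQSym_tensor\<close> below. Their values
  outside of \<open>QSym\<close> and \<open>BQSym\<close> are irrelevant, since \<open>F_QSym_in_QSym\<close> and \<open>F_BQSym_in_BQSym\<close> hold.
\<close>

definition delta_QSym :: "'k::field series \<Rightarrow> (mono \<times> mono \<Rightarrow> 'k)" where
  "delta_QSym = fsp.construct (M_QSym ` compositions)
     (\<lambda>b. let \<alpha> = the_inv_into compositions M_QSym b in
            \<Sum>i\<le>length \<alpha>. M_QSym (take i \<alpha>) \<otimes> M_QSym (drop i \<alpha>))"

definition s_pow :: "nat \<Rightarrow> (nat \<Rightarrow> 'k::field)" where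
  "s_pow p = coeff (monom 1 p)"

definition polys_s :: "(nat \<Rightarrow> 'k::field) set" where
  "polys_s = range coeff"

definition BQSym :: "(nat \<times> mono \<Rightarrow> 'k::field) set" where
  "BQSym = tensor_space polys_s QSym"

definition BQSym_basis_elem :: "nat \<times> nat list \<Rightarrow> (nat \<times> mono \<Rightarrow> 'k::field)" where
  "BQSym_basis_elem = (\<lambda>(p, \<alpha>). s_pow p \<otimes> M_QSym \<alpha>)"

definition delta_BQSym :: "(nat \<times> mono \<Rightarrow> 'k::field) \<Rightarrow> ((nat \<times> mono) \<times> mono \<Rightarrow> 'k)" where
  "delta_BQSym = fsp.construct (BQSym_basis_elem ` (UNIV \<times> compositions))
     (\<lambda>b. let (p, \<alpha>) = the_inv_into (UNIV \<times> compositions) BQSym_basis_elem b in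
            tensor_assoc (s_pow p \<otimes> delta_QSym (M_QSym \<alpha>)))"


section \<open>Graded posets\<close>

text \<open>A poset is given by its reflexive order relation \<open>r\<close>; its elements are \<open>Field r\<close>.\<close>

definition is_bot :: "'a rel \<Rightarrow> 'a \<Rightarrow> bool" where
  "is_bot r b \<longleftrightarrow> b \<in> Field r \<and> (\<forall>x\<in>Field r. (b, x) \<in> r)"

definition is_top :: "'a rel \<Rightarrow> 'a \<Rightarrow> bool" where
  "is_top r t \<longleftrightarrow> t \<in> Field r \<and> (\<forall>x\<in>Field r. (x, t) \<in> r)"

definition pbot :: "'a rel \<Rightarrow> 'a" where "pbot r = (THE b. is_bot r b)"

definition ptop :: "'a rel \<Rightarrow> 'a" where "ptop r = (THE t. is_top r t)"

definition covered_by :: "'a rel \<Rightarrow> 'a \<Rightarrow> 'a \<Rightarrow> bool" where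
  "covered_by r x y \<longleftrightarrow> (x, y) \<in> r \<and> x \<noteq> y \<and> (\<forall>z. (x, z) \<in> r \<and> (z, y) \<in> r \<longrightarrow> z = x \<or> z = y)"

text \<open>The values outside of the poset are fixed so that a rank function is unique as a total function.\<close>

definition is_rank :: "'a rel \<Rightarrow> ('a \<Rightarrow> nat) \<Rightarrow> bool" where
  "is_rank r \<rho> \<longleftrightarrow> (\<forall>b. is_bot r b \<longrightarrow> \<rho> b = 0) \<and>
     (\<forall>x y. covered_by r x y \<longrightarrow> \<rho> y = \<rho> x + 1) \<and> (\<forall>x. x \<notin> Field r \<longrightarrow> \<rho> x = 0)"

definition graded_poset :: "'a rel \<Rightarrow> bool" where
  "graded_poset r \<longleftrightarrow> finite (Field r) \<and> partial_order_on (Field r) r \<and>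
     (\<exists>b. is_bot r b) \<and> (\<exists>t. is_top r t) \<and> (\<exists>\<rho>. is_rank r \<rho>)"

definition poset_rank :: "'a rel \<Rightarrow> 'a \<Rightarrow> nat" where
  "poset_rank r = (THE \<rho>. is_rank r \<rho>)"

definition poset_interval :: "'a rel \<Rightarrow> 'a \<Rightarrow> 'a \<Rightarrow> 'a rel" where
  "poset_interval r x y = Restr r {z. (x, z) \<in> r \<and> (z, y) \<in> r}"


section \<open>The quasisymmetric functions of a graded poset\<close>

definition multichains :: "'a rel \<Rightarrow> nat \<Rightarrow> 'a list set" where
  "multichains r m = {xs. length xs = Suc m \<and> xs ! 0 = pbot r \<and> xs ! m = ptop r \<and>
     (\<forall>i<m. (xs ! i, xs ! Suc i) \<in> r)}"

definition F_approx :: "'a rel \<Rightarrow> nat \<Rightarrow> 'k::field series" where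
  "F_approx r m = (\<Sum>xs\<in>multichains r m. mono_series
     (\<Sum>i<m. Poly_Mapping.single i (poset_rank r (xs ! Suc i) - poset_rank r (xs ! i))))"

text \<open>
  The limit is taken in the usual topology of formal power series, i.e. every coefficient is
  eventually constant.
\<close>

definition F_QSym :: "'a rel \<Rightarrow> 'k::field series" where
  "F_QSym r = (THE f. limitin (product_topology (\<lambda>_. discrete_topology UNIV) UNIV)
            (F_approx r) f sequentially)"

definition F_BQSym :: "'a rel \<Rightarrow> (nat \<times> mono \<Rightarrow> 'k::field)" where
  "F_BQSym r = (\<Sum>x \<in> Field r - {pbot r}.
     s_pow (poset_rank r x - 1) \<otimes> F_QSym (poset_interval r x (ptop r)))"


section \<open>Well-definedness\<close>

lemma sum_fun_apply: "(\<Sum>x\<in>A. f x) i = (\<Sum>x\<in>A. f x i)"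
  by (induction A rule: infinite_finite_induct) auto

subsection \<open>Tensor products\<close>

lemma tensor_independent:
  assumes "fs.independent A" "fs.independent B"
  shows "inj_on (\<lambda>(a, b). a \<otimes> b) (A \<times> B)" "fs.independent ((\<lambda>(a, b). a \<otimes> b) ` (A \<times> B))"
proof -
  have key: "c (a, b) = 0"
    if fin: "finite A'" "finite B'" and sub: "A' \<subseteq> A" "B' \<subseteq> B" and ab: "a \<in> A'" "b \<in> B'"
      and z: "(\<Sum>p\<in>A'\<times>B'. fscale (c p) (fst p \<otimes> snd p)) = 0" for A' B' c a b
  proof -
    have iA: "fs.independent A'" and iB: "fs.independent B'"
      using assms sub fs.independent_mono by blast+
    have "(\<Sum>b\<in>B'. c (a, b) * b j) = 0" if "a \<in> A'" for a j
    proof -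
      have "(\<Sum>a\<in>A'. fscale (\<Sum>b\<in>B'. c (a, b) * b j) a) = 0"
      proof
        fix i
        have "(\<Sum>p\<in>A'\<times>B'. fscale (c p) (fst p \<otimes> snd p)) (i, j) = 0"
          using z by simp
        then have "(\<Sum>a\<in>A'. \<Sum>b\<in>B'. c (a, b) * (a i * b j)) = 0"
          by (simp add: sum_fun_apply fscale_def tensor_def sum.cartesian_product case_prod_unfold)
        then show "(\<Sum>a\<in>A'. fscale (\<Sum>b\<in>B'. c (a, b) * b j) a) i = 0 i"
          by (simp add: sum_fun_apply fscale_def sum_distrib_right sum_distrib_left mult_ac)
      qed
      then show ?thesis
        using fs.independentD[OF iA fin(1) order_refl, of "\<lambda>a. \<Sum>b\<in>B'. c (a, b) * b j"] that by blast
    qed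
    then have "(\<Sum>b\<in>B'. fscale (c (a, b)) b) = 0"
      using ab by (auto simp: fun_eq_iff sum_fun_apply fscale_def)
    then show ?thesis
      using fs.independentD[OF iB fin(2) order_refl, of "\<lambda>b. c (a, b)"] ab by blast
  qed
  show inj: "inj_on (\<lambda>(a, b). a \<otimes> b) (A \<times> B)"
  proof (rule inj_onI; clarify; rule ccontr)
    fix a b a' b' assume in': "a \<in> A" "b \<in> B" "a' \<in> A" "b' \<in> B" and eq: "a \<otimes> b = a' \<otimes> b'"
      and ne: "\<not> (a = a' \<and> b = b')"
    let ?c = "\<lambda>p. if p = (a, b) then 1 else if p = (a', b') then - 1 else (0::'a)"
    have "(\<Sum>p\<in>{a,a'}\<times>{b,b'}. fscale (?c p) (fst p \<otimes> snd p))
        = (\<Sum>p\<in>{(a,b),(a',b')}. fscale (?c p) (fst p \<otimes> snd p))"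
      by (rule sum.mono_neutral_right) auto
    also have "\<dots> = 0"
      using ne eq by (auto simp: fscale_def fun_eq_iff)
    finally have "?c (a, b) = 0"
      using in' by (intro key[of "{a,a'}" "{b,b'}"]) auto
    then show False by simp
  qed
  show "fs.independent ((\<lambda>(a, b). a \<otimes> b) ` (A \<times> B))"
    unfolding fs.independent_explicit_finite_subsets
  proof (intro allI impI ballI)
    fix S u v assume S: "S \<subseteq> (\<lambda>(a, b). a \<otimes> b) ` (A \<times> B)" and "finite S"
      and z: "(\<Sum>v\<in>S. fscale (u v) v) = 0" and v: "v \<in> S"
    from S \<open>finite S\<close> obtain P where P: "P \<subseteq> A \<times> B" "finite P" "S = (\<lambda>(a, b). a \<otimes> b) ` P"
      by (meson finite_subset_image)
    have injP: "inj_on (\<lambda>(a, b). a \<otimes> b) P"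
      using inj P(1) inj_on_subset by blast
    define c where "c p = (if p \<in> P then u (fst p \<otimes> snd p) else 0)" for p
    have "(\<Sum>p\<in>fst ` P \<times> snd ` P. fscale (c p) (fst p \<otimes> snd p))
        = (\<Sum>p\<in>P. fscale (c p) (fst p \<otimes> snd p))"
      by (rule sum.mono_neutral_right) (use P in \<open>auto simp: c_def rev_image_eqI\<close>)
    also have "\<dots> = (\<Sum>v\<in>S. fscale (u v) v)"
      unfolding P(3) sum.reindex[OF injP] by (auto simp: c_def intro!: sum.cong)
    finally have z': "(\<Sum>p\<in>fst ` P \<times> snd ` P. fscale (c p) (fst p \<otimes> snd p)) = 0"
      using z by simp
    obtain a b where ab: "(a, b) \<in> P" "v = a \<otimes> b"
      using v P(3) by auto
    have "c (a, b) = 0"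
      by (rule key[of "fst ` P" "snd ` P"]) (use P ab z' in \<open>auto intro: rev_image_eqI\<close>)
    then show "u v = 0"
      using ab by (simp add: c_def)
  qed
qed

lemma linear_tensor_right: "Vector_Spaces.linear fscale fscale (\<lambda>g. f \<otimes> g)"
  by unfold_locales (auto simp: fun_eq_iff tensor_def fscale_def algebra_simps)

lemma linear_tensor_left: "Vector_Spaces.linear fscale fscale (\<lambda>f. f \<otimes> g)"
  by unfold_locales (auto simp: fun_eq_iff tensor_def fscale_def algebra_simps)

lemma linear_tensor_assoc: "Vector_Spaces.linear fscale fscale tensor_assoc"
  by unfold_locales (auto simp: fun_eq_iff tensor_assoc_def fscale_def algebra_simps)

lemma tensor_assoc_tensor: "tensor_assoc (f \<otimes> g \<otimes> h) = (f \<otimes> g) \<otimes> h"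
  by (auto simp: fun_eq_iff tensor_assoc_def tensor_def)

lemma dual_independent:
  fixes f :: "'b \<Rightarrow> 'i \<Rightarrow> 'k::field"
  assumes d: "\<And>a b. a \<in> I \<Longrightarrow> b \<in> I \<Longrightarrow> f a (x b) = (if a = b then 1 else 0)"
  shows "inj_on f I" "fs.independent (f ` I)"
proof -
  show inj: "inj_on f I"
    by (rule inj_onI) (metis d zero_neq_one)
  show "fs.independent (f ` I)"
    unfolding fs.independent_explicit_finite_subsets
  proof (intro allI impI ballI)
    fix S u v assume S: "S \<subseteq> f ` I" "finite S"
      and z: "(\<Sum>v\<in>S. fscale (u v) v) = 0" and v: "v \<in> S"
    obtain P where P: "P \<subseteq> I" "finite P" "S = f ` P"
      using S by (meson finite_subset_image)
    have injP: "inj_on f P" using inj P(1) inj_on_subset by blast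
    obtain b where b: "b \<in> P" "v = f b" using v P by auto
    have "0 = (\<Sum>v\<in>S. fscale (u v) v) (x b)" using z by simp
    also have "\<dots> = (\<Sum>a\<in>P. u (f a) * f a (x b))"
      unfolding P(3) sum.reindex[OF injP] by (simp add: sum_fun_apply fscale_def)
    also have "\<dots> = (\<Sum>a\<in>P. if a = b then u (f a) else 0)"
    proof (rule sum.cong[OF refl])
      fix a assume "a \<in> P"
      then have "f a (x b) = (if a = b then 1 else 0)" using P(1) b(1) by (intro d) auto
      then show "u (f a) * f a (x b) = (if a = b then u (f a) else 0)" by simp
    qed
    also have "\<dots> = u v" using b P by simp
    finally show "u v = 0" by simp
  qed
qed

subsection \<open>The monomial basis\<close>

text \<open>The sequence of the nonzero exponents of a monomial.\<close>

definition comp_of :: "mono \<Rightarrow> nat list" where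
  "comp_of m = map (Poly_Mapping.lookup m) (sorted_list_of_set (Poly_Mapping.keys m))"

lemma index_sequence_iff:
  assumes \<alpha>: "\<alpha> \<in> compositions"
  shows "sorted_wrt (<) is \<and> length is = length \<alpha> \<and>
            m = (\<Sum>j<length \<alpha>. Poly_Mapping.single (is ! j) (\<alpha> ! j))
     \<longleftrightarrow> is = sorted_list_of_set (Poly_Mapping.keys m) \<and> comp_of m = \<alpha>" (is "?L \<longleftrightarrow> ?R")
proof
  assume L: ?L
  then have dist: "distinct is" and sorted: "sorted is" and len: "length is = length \<alpha>"
    using strict_sorted_iff by blast+
  have lk: "Poly_Mapping.lookup m k = (\<Sum>j<length \<alpha>. if is ! j = k then \<alpha> ! j else 0)" for k
    using L by (simp add: lookup_sum lookup_single when_def)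
  have at: "Poly_Mapping.lookup m (is ! i) = \<alpha> ! i" if "i < length \<alpha>" for i
  proof -
    have "Poly_Mapping.lookup m (is ! i) = (\<Sum>j<length \<alpha>. if j = i then \<alpha> ! j else 0)"
      unfolding lk using that dist len by (intro sum.cong) (auto simp: nth_eq_iff_index_eq)
    then show ?thesis using that by simp
  qed
  have keys: "Poly_Mapping.keys m = set is"
  proof (intro equalityI subsetI)
    fix k assume "k \<in> Poly_Mapping.keys m"
    then have "(\<Sum>j<length \<alpha>. if is ! j = k then \<alpha> ! j else 0) \<noteq> 0"
      by (simp add: in_keys_iff lk)
    then obtain j where "j \<in> {..<length \<alpha>}" "(if is ! j = k then \<alpha> ! j else 0) \<noteq> 0"
      by (rule sum.not_neutral_contains_not_neutral)
    then show "k \<in> set is" using len nth_mem[of j "is"] by (auto split: if_splits)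
  next
    fix k assume "k \<in> set is"
    then obtain i where i: "i < length \<alpha>" "k = is ! i" using len by (metis in_set_conv_nth)
    have "1 \<le> \<alpha> ! i" using \<alpha> nth_mem[OF i(1)] unfolding compositions_def by blast
    then have "Poly_Mapping.lookup m k \<noteq> 0" using at[OF i(1)] i(2) by simp
    then show "k \<in> Poly_Mapping.keys m" by (simp add: in_keys_iff)
  qed
  have "is = sorted_list_of_set (Poly_Mapping.keys m)"
    unfolding keys using sorted dist by (simp add: sorted_list_of_set.idem_if_sorted_distinct)
  moreover from this have "comp_of m = \<alpha>"
    unfolding comp_of_def by (metis at len nth_equalityI length_map nth_map)
  ultimately show ?R by simp
next
  assume R: ?R
  let ?K = "Poly_Mapping.keys m"
  have len: "length is = length \<alpha>"
    using R by (metis comp_of_def length_map)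
  have strict: "sorted_wrt (<) is" and set: "set is = ?K" and dist: "distinct is"
    using R by auto
  have nth: "\<alpha> ! j = Poly_Mapping.lookup m (is ! j)" if "j < length \<alpha>" for j
    using R that len by (metis comp_of_def nth_map)
  have "m = (\<Sum>k\<in>?K. Poly_Mapping.single k (Poly_Mapping.lookup m k))"
    by (rule poly_mapping_eqI) (simp add: lookup_sum lookup_single when_def in_keys_iff)
  also have "\<dots> = (\<Sum>j<length \<alpha>. Poly_Mapping.single (is ! j) (Poly_Mapping.lookup m (is ! j)))"
    using sum.reindex_bij_betw[OF bij_betw_nth[OF dist refl refl], symmetric]
    by (simp add: set len)
  also have "\<dots> = (\<Sum>j<length \<alpha>. Poly_Mapping.single (is ! j) (\<alpha> ! j))"
    by (simp add: nth)
  finally show ?L using strict len by blast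
qed

lemma M_QSym_apply:
  assumes "\<alpha> \<in> compositions"
  shows "M_QSym \<alpha> m = (if comp_of m = \<alpha> then 1 else 0)"
  unfolding M_QSym_def index_sequence_iff[OF assms] by simp

lemma comp_of_exists:
  assumes "\<alpha> \<in> compositions"
  obtains m where "comp_of m = \<alpha>"
  using index_sequence_iff[OF assms, of "[0..<length \<alpha>]" "\<Sum>j<length \<alpha>. Poly_Mapping.single ([0..<length \<alpha>] ! j) (\<alpha> ! j)"]
  by (auto simp: sorted_wrt_upt)

lemma comp_of_some: "\<alpha> \<in> compositions \<Longrightarrow> comp_of (SOME m. comp_of m = \<alpha>) = \<alpha>"
  by (metis (mono_tags) comp_of_exists someI_ex)

lemma M_QSym_inj: "inj_on (M_QSym :: nat list \<Rightarrow> 'k::field series) compositions"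
  and M_QSym_independent: "fs.independent (M_QSym ` compositions :: 'k series set)"
  by (rule dual_independent[where x = "\<lambda>\<alpha>. SOME m. comp_of m = \<alpha>"];
      auto simp: M_QSym_apply comp_of_some)+

lemma linear_delta_QSym: "Vector_Spaces.linear fscale fscale delta_QSym"
  unfolding delta_QSym_def by (rule fsp.linear_construct[OF M_QSym_independent])

lemma delta_QSym_M:
  assumes "\<alpha> \<in> compositions"
  shows "delta_QSym (M_QSym \<alpha>) = (\<Sum>i\<le>length \<alpha>. M_QSym (take i \<alpha>) \<otimes> M_QSym (drop i \<alpha>))"
  unfolding delta_QSym_def using assms
  by (subst fsp.construct_basis[OF M_QSym_independent]) (auto simp: the_inv_into_f_f[OF M_QSym_inj])

lemma BQSym_basis_inj:
    "inj_on (BQSym_basis_elem :: _ \<Rightarrow> _ \<Rightarrow> 'k::field) (UNIV \<times> compositions)"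
  and BQSym_basis_independent:
    "fs.independent (BQSym_basis_elem ` (UNIV \<times> compositions) :: (_ \<Rightarrow> 'k) set)"
  by (rule dual_independent[where x = "\<lambda>(p, \<alpha>). (p, SOME m. comp_of m = \<alpha>)"];
      auto simp: M_QSym_apply comp_of_some BQSym_basis_elem_def tensor_def s_pow_def split: if_splits)+

lemma polys_s_span: "polys_s = fs.span (range s_pow)"
proof (intro equalityI subsetI)
  fix f :: "nat \<Rightarrow> 'a" assume "f \<in> polys_s"
  then obtain q where q: "f = coeff q" by (auto simp: polys_s_def)
  have "f = (\<Sum>p\<le>degree q. fscale (coeff q p) (s_pow p))"
  proof
    fix i
    have "(\<Sum>p\<le>degree q. fscale (coeff q p) (s_pow p)) i
        = (\<Sum>p\<le>degree q. if i = p then coeff q p else 0)"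
      unfolding sum_fun_apply by (rule sum.cong) (auto simp: fscale_def s_pow_def)
    then show "f i = (\<Sum>p\<le>degree q. fscale (coeff q p) (s_pow p)) i"
      by (simp add: q coeff_eq_0)
  qed
  also have "\<dots> \<in> fs.span (range s_pow)"
    by (intro fs.span_sum fs.span_scale fs.span_base) auto
  finally show "f \<in> fs.span (range s_pow)" .
next
  have "fs.subspace (polys_s :: (nat \<Rightarrow> 'a) set)"
  proof (rule fs.subspaceI)
    show "(0::nat \<Rightarrow> 'a) \<in> polys_s"
      unfolding polys_s_def by (rule range_eqI[of _ _ 0]) auto
    fix f g :: "nat \<Rightarrow> 'a" and c
    assume "f \<in> polys_s"
    then obtain q where q: "f = coeff q" by (auto simp: polys_s_def)
    show "fscale c f \<in> polys_s"
      unfolding polys_s_def by (rule range_eqI[of _ _ "smult c q"]) (auto simp: q fscale_def)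
    assume "g \<in> polys_s"
    then obtain q' where q': "g = coeff q'" by (auto simp: polys_s_def)
    show "f + g \<in> polys_s"
      unfolding polys_s_def by (rule range_eqI[of _ _ "q + q'"]) (auto simp: q q')
  qed
  then show "f \<in> polys_s" if "f \<in> fs.span (range s_pow)" for f :: "nat \<Rightarrow> 'a"
    using fs.span_minimal[of "range s_pow" polys_s] that by (auto simp: polys_s_def s_pow_def)
qed

lemma BQSym_basis_elemI:
  "\<alpha> \<in> compositions \<Longrightarrow> s_pow p \<otimes> M_QSym \<alpha> \<in> BQSym_basis_elem ` (UNIV \<times> compositions)"
  by (rule image_eqI[of _ _ "(p, \<alpha>)"]) (auto simp: BQSym_basis_elem_def)

lemma BQSym_span: "BQSym = fs.span (BQSym_basis_elem ` (UNIV \<times> compositions))" (is "_ = ?R")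
proof
  have 1: "s_pow p \<otimes> g \<in> ?R" if "g \<in> QSym" for p and g :: "'a series"
  proof -
    interpret Vector_Spaces.linear fscale fscale "\<lambda>g. s_pow p \<otimes> (g :: 'a series)"
      by (rule linear_tensor_right)
    have "s_pow p \<otimes> g \<in> fs.span ((\<lambda>g. s_pow p \<otimes> g) ` M_QSym ` compositions)"
      using that span_image[of "M_QSym ` compositions"] by (auto simp: QSym_def)
    also have "\<dots> \<subseteq> ?R"
      by (rule fs.span_mono) (use BQSym_basis_elemI in blast)
    finally show ?thesis .
  qed
  have 2: "f \<otimes> g \<in> ?R" if "f \<in> polys_s" "g \<in> QSym" for f and g :: "'a series"
  proof -
    interpret Vector_Spaces.linear fscale fscale "\<lambda>f. (f :: nat \<Rightarrow> 'a) \<otimes> g"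
      by (rule linear_tensor_left)
    have "f \<otimes> g \<in> fs.span ((\<lambda>f. f \<otimes> g) ` range s_pow)"
      using that span_image[of "range s_pow"] by (auto simp: polys_s_span)
    also have "\<dots> \<subseteq> ?R"
      by (rule fs.span_minimal) (use 1 that in auto)
    finally show ?thesis .
  qed
  show "BQSym \<subseteq> ?R"
    unfolding BQSym_def tensor_space_def by (rule fs.span_minimal) (use 2 in auto)
  show "?R \<subseteq> BQSym"
    unfolding BQSym_def tensor_space_def
  proof (rule fs.span_mono, clarify)
    fix p :: nat and \<alpha> assume "\<alpha> \<in> compositions"
    then have "M_QSym \<alpha> \<in> (QSym :: 'a series set)" unfolding QSym_def by (intro fs.span_base) auto
    moreover have "s_pow p \<in> (polys_s :: (nat \<Rightarrow> 'a) set)" by (simp add: polys_s_def s_pow_def)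
    ultimately show "\<exists>f g. BQSym_basis_elem (p, \<alpha>) = f \<otimes> g \<and> f \<in> polys_s \<and> g \<in> (QSym :: 'a series set)"
      unfolding BQSym_basis_elem_def by auto
  qed
qed

lemma linear_delta_BQSym: "Vector_Spaces.linear fscale fscale delta_BQSym"
  unfolding delta_BQSym_def by (rule fsp.linear_construct[OF BQSym_basis_independent])

lemma delta_BQSym_tensor:
  assumes "f \<in> QSym"
  shows "delta_BQSym (s_pow p \<otimes> f) = tensor_assoc (s_pow p \<otimes> delta_QSym f)"
proof -
  have basis: "delta_BQSym (s_pow p \<otimes> M_QSym \<alpha>) = tensor_assoc (s_pow p \<otimes> delta_QSym (M_QSym \<alpha>))"
    if "\<alpha> \<in> compositions" for \<alpha>
  proof -
    have e: "s_pow p \<otimes> M_QSym \<alpha> = BQSym_basis_elem (p, \<alpha>)" by (simp add: BQSym_basis_elem_def)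
    show ?thesis
      unfolding delta_BQSym_def e using that
      by (subst fsp.construct_basis[OF BQSym_basis_independent])
        (auto simp: the_inv_into_f_f[OF BQSym_basis_inj])
  qed
  have l1: "Vector_Spaces.linear fscale fscale (\<lambda>f. delta_BQSym (s_pow p \<otimes> f))"
    using Vector_Spaces.linear_compose[OF linear_tensor_right linear_delta_BQSym]
    by (simp add: o_def)
  have l2: "Vector_Spaces.linear fscale fscale (\<lambda>f. tensor_assoc (s_pow p \<otimes> delta_QSym f))"
    using Vector_Spaces.linear_compose[OF Vector_Spaces.linear_compose[OF
        linear_delta_QSym linear_tensor_right] linear_tensor_assoc]
    by (simp add: o_def)
  show ?thesis
    by (rule fsp.linear_eq_on[OF l1 l2, of _ "M_QSym ` compositions"]) (use assms basis in \<open>auto simp: QSym_def\<close>)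
qed


subsection \<open>Graded posets\<close>

lemma pbot_eq: "graded_poset r \<Longrightarrow> is_bot r b \<Longrightarrow> pbot r = b"
  unfolding pbot_def graded_poset_def partial_order_on_def is_bot_def antisym_def by blast

lemma ptop_eq: "graded_poset r \<Longrightarrow> is_top r t \<Longrightarrow> ptop r = t"
  unfolding ptop_def graded_poset_def partial_order_on_def is_top_def antisym_def by blast

lemma is_bot_pbot: "graded_poset r \<Longrightarrow> is_bot r (pbot r)"
  by (metis graded_poset_def pbot_eq)

lemma is_top_ptop: "graded_poset r \<Longrightarrow> is_top r (ptop r)"
  by (metis graded_poset_def ptop_eq)

context
  fixes r :: "'a rel"
  assumes g: "graded_poset r"
begin

lemma poset_trans: "(x, y) \<in> r \<Longrightarrow> (y, z) \<in> r \<Longrightarrow> (x, z) \<in> r"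
  using g unfolding graded_poset_def partial_order_on_def preorder_on_def trans_def by blast

lemma poset_antisym: "(x, y) \<in> r \<Longrightarrow> (y, x) \<in> r \<Longrightarrow> x = y"
  using g unfolding graded_poset_def partial_order_on_def antisym_def by blast

lemma poset_refl: "x \<in> Field r \<Longrightarrow> (x, x) \<in> r"
  using g unfolding graded_poset_def partial_order_on_def preorder_on_def refl_on_def by blast

lemma poset_finite: "finite (Field r)"
  using g unfolding graded_poset_def by blast

lemma poset_Field: "(x, y) \<in> r \<Longrightarrow> x \<in> Field r \<and> y \<in> Field r"
  by (auto simp: Field_def)

lemma down_finite: "finite {z. (z, y) \<in> r}"
  by (rule finite_subset[OF _ poset_finite]) (auto simp: Field_def)

lemma poset_less_induct:
  assumes "\<And>y. (\<And>z. (z, y) \<in> r \<Longrightarrow> z \<noteq> y \<Longrightarrow> P z) \<Longrightarrow> P y"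
  shows "P y"
proof (induction "card {z. (z, y) \<in> r}" arbitrary: y rule: less_induct)
  case less
  show ?case
  proof (rule assms)
    fix z assume z: "(z, y) \<in> r" "z \<noteq> y"
    have "{w. (w, z) \<in> r} \<subset> {w. (w, y) \<in> r}"
    proof
      show "{w. (w, z) \<in> r} \<subseteq> {w. (w, y) \<in> r}" using z poset_trans by blast
      have "(y, y) \<in> r" "(y, z) \<notin> r" using z poset_antisym poset_Field poset_refl by blast+
      then show "{w. (w, z) \<in> r} \<noteq> {w. (w, y) \<in> r}" by blast
    qed
    then have "card {w. (w, z) \<in> r} < card {w. (w, y) \<in> r}" by (rule psubset_card_mono[OF down_finite])
    then show "P z" by (rule less)
  qed
qed

lemma cover_exists:
  assumes "(x, y) \<in> r" "x \<noteq> y"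
  obtains z where "(x, z) \<in> r" "covered_by r z y"
  using assms
proof (induction "card {z. (z, y) \<in> r \<and> (x, z) \<in> r}" arbitrary: x thesis rule: less_induct)
  case less
  show ?case
  proof (cases "covered_by r x y")
    case True
    then show ?thesis using less.prems(1)[of x] less.prems(2) poset_refl poset_Field by blast
  next
    case False
    then obtain w where w: "(x, w) \<in> r" "(w, y) \<in> r" "w \<noteq> x" "w \<noteq> y"
      using less.prems by (auto simp: covered_by_def)
    have "{z. (z, y) \<in> r \<and> (w, z) \<in> r} \<subset> {z. (z, y) \<in> r \<and> (x, z) \<in> r}"
      using w poset_trans poset_antisym poset_Field poset_refl less.prems by blast
    moreover have "finite {z. (z, y) \<in> r \<and> (x, z) \<in> r}"
      by (rule finite_subset[OF _ down_finite[of y]]) auto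
    ultimately have "card {z. (z, y) \<in> r \<and> (w, z) \<in> r} < card {z. (z, y) \<in> r \<and> (x, z) \<in> r}"
      by (simp add: psubset_card_mono)
    then obtain z where "(w, z) \<in> r" "covered_by r z y"
      using less.hyps[of w] w by metis
    then show ?thesis using less.prems(1) w(1) poset_trans by blast
  qed
qed

lemma is_rank_unique:
  assumes "is_rank r \<rho>" "is_rank r \<sigma>"
  shows "\<rho> = \<sigma>"
proof
  fix y show "\<rho> y = \<sigma> y"
  proof (induction y rule: poset_less_induct)
    case (1 y)
    consider "y \<notin> Field r" | "y = pbot r" | "y \<in> Field r" "y \<noteq> pbot r" by blast
    then show ?case
    proof cases
      case 3
      then have "(pbot r, y) \<in> r" using is_bot_pbot[OF g] by (auto simp: is_bot_def)
      then obtain z where z: "covered_by r z y" using 3 cover_exists by metis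
      then have "\<rho> z = \<sigma> z" using 1 by (auto simp: covered_by_def)
      with z show ?thesis using assms by (metis is_rank_def)
    qed (use assms is_bot_pbot[OF g] in \<open>auto simp: is_rank_def\<close>)
  qed
qed

end

lemma is_rank_poset_rank:
  assumes g: "graded_poset r"
  shows "is_rank r (poset_rank r)"
proof -
  obtain \<rho> where "is_rank r \<rho>" using g by (auto simp: graded_poset_def)
  then show ?thesis
    unfolding poset_rank_def using is_rank_unique[OF g] by (metis theI)
qed

context
  fixes r :: "'a rel"
  assumes g: "graded_poset r"
begin

lemmas ptrans = poset_trans[OF g]
  and pantisym = poset_antisym[OF g]
  and prefl = poset_refl[OF g]
  and prank = is_rank_poset_rank[OF g]

lemma poset_rank_mono: "(x, y) \<in> r \<Longrightarrow> x \<noteq> y \<Longrightarrow> poset_rank r x < poset_rank r y"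
proof (induction y rule: poset_less_induct[OF g])
  case (1 y)
  obtain z where z: "(x, z) \<in> r" "covered_by r z y" using cover_exists[OF g 1(2,3)] by metis
  have zy: "(z, y) \<in> r" "z \<noteq> y" using z(2) by (auto simp: covered_by_def)
  have "poset_rank r x \<le> poset_rank r z"
    using 1(1)[OF zy z(1)] by (cases "x = z") auto
  moreover have "poset_rank r y = poset_rank r z + 1"
    using prank z by (auto simp: is_rank_def)
  ultimately show ?case by simp
qed

lemma graded_poset_interval:
  assumes xy: "(x, y) \<in> r"
  shows "graded_poset (poset_interval r x y)" (is "graded_poset ?I")
    and "Field (poset_interval r x y) = {z. (x, z) \<in> r \<and> (z, y) \<in> r}" (is "_ = ?A")
    and "pbot (poset_interval r x y) = x" and "ptop (poset_interval r x y) = y"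
    and "(x, z) \<in> r \<Longrightarrow> (z, y) \<in> r \<Longrightarrow>
           poset_rank (poset_interval r x y) z = poset_rank r z - poset_rank r x"
proof -
  show Fld: "Field ?I = ?A"
  proof (intro equalityI subsetI)
    fix z assume "z \<in> ?A"
    then have "(z, z) \<in> ?I" using prefl poset_Field[OF g] by (auto simp: poset_interval_def)
    then show "z \<in> Field ?I" by (rule FieldI1)
  qed (auto simp: poset_interval_def Field_def)
  have po: "partial_order_on (Field ?I) ?I"
    unfolding partial_order_on_def preorder_on_def
  proof (intro conjI)
    show "?I \<subseteq> Field ?I \<times> Field ?I" by (auto simp: Field_def)
    show "refl_on (Field ?I) ?I"
      unfolding Fld refl_on_def using prefl poset_Field[OF g] by (auto simp: poset_interval_def)
    show "trans ?I"
      by (rule transI) (auto simp: poset_interval_def intro: ptrans)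
    show "antisym ?I"
      by (rule antisymI) (auto simp: poset_interval_def intro: pantisym)
  qed
  have bot: "is_bot ?I x" and top: "is_top ?I y"
    unfolding is_bot_def is_top_def Fld using xy prefl poset_Field[OF g]
    by (auto simp: poset_interval_def)
  have anti: "antisym ?I" using po by (simp add: partial_order_on_def)
  define \<rho> where "\<rho> = (\<lambda>z. if z \<in> ?A then poset_rank r z - poset_rank r x else 0)"
  have le: "poset_rank r x \<le> poset_rank r z" if "(x, z) \<in> r" for z
    using poset_rank_mono[OF that] by (cases "x = z") auto
  have rank: "is_rank ?I \<rho>"
    unfolding is_rank_def
  proof (intro conjI allI impI)
    fix b assume "is_bot ?I b"
    then have "b = x" using bot anti by (auto simp: is_bot_def antisym_def)
    then show "\<rho> b = 0" by (simp add: \<rho>_def)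
  next
    fix z w assume c: "covered_by ?I z w"
    then have zw: "z \<in> ?A" "w \<in> ?A" "(z, w) \<in> r"
      by (auto simp: covered_by_def poset_interval_def)
    have "covered_by r z w"
      using c zw ptrans unfolding covered_by_def poset_interval_def by blast
    then have "poset_rank r w = poset_rank r z + 1"
      using prank by (simp add: is_rank_def)
    then show "\<rho> w = \<rho> z + 1"
      using zw le[of z] by (simp add: \<rho>_def)
  next
    fix z assume "z \<notin> Field ?I"
    then show "\<rho> z = 0" by (auto simp: Fld \<rho>_def)
  qed
  have fin: "finite (Field ?I)"
    unfolding Fld by (rule finite_subset[OF _ down_finite[OF g, of y]]) auto
  show gI: "graded_poset ?I"
    unfolding graded_poset_def using fin po bot top rank by blast
  show "pbot ?I = x" "ptop ?I = y"
    using pbot_eq[OF gI bot] ptop_eq[OF gI top] by auto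
  show "poset_rank ?I z = poset_rank r z - poset_rank r x" if "(x, z) \<in> r" "(z, y) \<in> r"
  proof -
    have "poset_rank ?I = \<rho>"
      using is_rank_unique[OF gI is_rank_poset_rank[OF gI] rank] .
    then show ?thesis using that by (simp add: \<rho>_def)
  qed
qed


lemma poset_rank_le: "(x, y) \<in> r \<Longrightarrow> poset_rank r x \<le> poset_rank r y"
  using poset_rank_mono by (cases "x = y") (auto intro: less_imp_le)

lemma up_finite: "finite {y. (x, y) \<in> r \<and> P y}"
  by (rule finite_subset[OF _ poset_finite[OF g]]) (auto simp: Field_def)

end


subsection \<open>The limit defining the quasisymmetric function\<close>

text \<open>
  The number of multichains from \<open>x\<close> to the maximal element with prescribed rank increments.
\<close>

primrec chain_count :: "'a rel \<Rightarrow> nat list \<Rightarrow> 'a \<Rightarrow> nat" where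
  "chain_count r [] x = (if x = ptop r then 1 else 0)"
| "chain_count r (p # ps) x =
     (\<Sum>y | (x, y) \<in> r \<and> poset_rank r y - poset_rank r x = p. chain_count r ps y)"

definition rank_chains :: "'a rel \<Rightarrow> nat list \<Rightarrow> 'a \<Rightarrow> 'a list set" where
  "rank_chains r ps x = {xs. length xs = Suc (length ps) \<and> xs ! 0 = x \<and> xs ! length ps = ptop r \<and>
     (\<forall>i<length ps. (xs ! i, xs ! Suc i) \<in> r \<and>
        poset_rank r (xs ! Suc i) - poset_rank r (xs ! i) = ps ! i)}"

lemma rank_chains_Nil: "rank_chains r [] x = (if x = ptop r then {[x]} else {})"
  by (auto simp: rank_chains_def length_Suc_conv)

lemma rank_chains_Cons:
  "rank_chains r (p # ps) x =
     (\<Union>y\<in>{y. (x, y) \<in> r \<and> poset_rank r y - poset_rank r x = p}. (#) x ` rank_chains r ps y)"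
  (is "?L = ?R")
proof (rule set_eqI)
  fix xs
  show "xs \<in> ?L \<longleftrightarrow> xs \<in> ?R"
  proof (cases xs)
    case (Cons a zs)
    have "xs \<in> ?L \<longleftrightarrow> a = x \<and> (x, zs ! 0) \<in> r \<and> poset_rank r (zs ! 0) - poset_rank r x = p \<and>
        zs \<in> rank_chains r ps (zs ! 0)"
      unfolding Cons rank_chains_def by (simp add: All_less_Suc2) blast
    also have "\<dots> \<longleftrightarrow> xs \<in> ?R"
      unfolding Cons by (auto simp: rank_chains_def)
    finally show ?thesis .
  qed (auto simp: rank_chains_def)
qed

context
  fixes r :: "'a rel"
  assumes g: "graded_poset r"
begin

lemma card_rank_chains: "finite (rank_chains r ps x) \<and> card (rank_chains r ps x) = chain_count r ps x"
proof (induction ps arbitrary: x)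
  case Nil
  show ?case by (simp add: rank_chains_Nil)
next
  case (Cons p ps)
  let ?Y = "{y. (x, y) \<in> r \<and> poset_rank r y - poset_rank r x = p}"
  have "card (\<Union>y\<in>?Y. (#) x ` rank_chains r ps y) = (\<Sum>y\<in>?Y. card ((#) x ` rank_chains r ps y))"
  proof (rule card_UN_disjoint)
    show "finite ?Y" by (rule up_finite[OF g])
    show "\<forall>y\<in>?Y. finite ((#) x ` rank_chains r ps y)" using Cons by simp
    show "\<forall>y\<in>?Y. \<forall>z\<in>?Y. y \<noteq> z \<longrightarrow> (#) x ` rank_chains r ps y \<inter> (#) x ` rank_chains r ps z = {}"
      by (auto simp: rank_chains_def)
  qed
  also have "\<dots> = (\<Sum>y\<in>?Y. chain_count r ps y)"
    using Cons by (simp add: card_image)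
  finally show ?case
    unfolding rank_chains_Cons using Cons up_finite[OF g] by simp
qed

lemma chain_count_filter:
  "x \<in> Field r \<Longrightarrow> chain_count r ps x = chain_count r (filter (\<lambda>p. p \<noteq> 0) ps) x"
proof (induction ps arbitrary: x)
  case (Cons p ps)
  have IH: "chain_count r ps y = chain_count r (filter (\<lambda>p. p \<noteq> 0) ps) y" if "(x, y) \<in> r" for y
    using Cons.IH that by (auto simp: Field_def)
  show ?case
  proof (cases "p = 0")
    case True
    have "{y. (x, y) \<in> r \<and> poset_rank r y - poset_rank r x = 0} = {x}"
      using poset_rank_mono[OF g] poset_refl[OF g Cons.prems] by fastforce
    then show ?thesis using Cons True by simp
  next
    case False
    then show ?thesis using IH by simp
  qed
qed simp

lemma chain_count_nonzero:
  "chain_count r ps x \<noteq> 0 \<Longrightarrow> sum_list ps + poset_rank r x = poset_rank r (ptop r)"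
proof (induction ps arbitrary: x)
  case Nil
  then show ?case by (simp split: if_splits)
next
  case (Cons p ps)
  then obtain y where y: "(x, y) \<in> r" "poset_rank r y - poset_rank r x = p" "chain_count r ps y \<noteq> 0"
    using sum.not_neutral_contains_not_neutral[of "chain_count r ps"
        "{y. (x, y) \<in> r \<and> poset_rank r y - poset_rank r x = p}"] by auto
  then show ?case using Cons.IH[OF y(3)] poset_rank_le[OF g y(1)] by simp
qed

lemma finite_multichains: "finite (multichains r m)"
proof (rule finite_subset)
  show "multichains r m \<subseteq> {xs. set xs \<subseteq> Field r \<and> length xs = Suc m}"
  proof clarify
    fix xs assume xs: "xs \<in> multichains r m"
    have "xs ! i \<in> Field r" if "i \<le> m" for i
      using that xs is_bot_pbot[OF g]
      by (cases i) (auto simp: multichains_def is_bot_def dest!: spec[of _ "i - 1"] intro: FieldI2)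
    then show "set xs \<subseteq> Field r \<and> length xs = Suc m"
      using xs by (auto simp: multichains_def in_set_conv_nth)
  qed
  show "finite {xs. set xs \<subseteq> Field r \<and> length xs = Suc m}"
    by (rule finite_lists_length_eq[OF poset_finite[OF g]])
qed

lemma F_approx_apply:
  "F_approx r m mon = (if Poly_Mapping.keys mon \<subseteq> {..<m}
     then of_nat (chain_count r (map (Poly_Mapping.lookup mon) [0..<m]) (pbot r)) else 0)"
proof -
  let ?d = "\<lambda>xs i. poset_rank r (xs ! Suc i) - poset_rank r (xs ! i)"
  have eq: "mon = (\<Sum>i<m. Poly_Mapping.single i (?d xs i)) \<longleftrightarrow>
      Poly_Mapping.keys mon \<subseteq> {..<m} \<and> (\<forall>i<m. ?d xs i = Poly_Mapping.lookup mon i)" for xs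
  proof -
    have "Poly_Mapping.lookup (\<Sum>i<m. Poly_Mapping.single i (?d xs i)) k = (if k < m then ?d xs k else 0)" for k
      by (simp add: lookup_sum lookup_single when_def)
    then have *: "mon = (\<Sum>i<m. Poly_Mapping.single i (?d xs i)) \<longleftrightarrow>
        (\<forall>k. Poly_Mapping.lookup mon k = (if k < m then ?d xs k else 0))"
      by (simp add: poly_mapping_eq_iff fun_eq_iff)
    have **: "Poly_Mapping.keys mon \<subseteq> {..<m} \<longleftrightarrow> (\<forall>k. \<not> k < m \<longrightarrow> Poly_Mapping.lookup mon k = 0)"
      by (auto simp: subset_iff in_keys_iff)
    show ?thesis unfolding * ** by metis
  qed
  have "F_approx r m mon = of_nat (card {xs \<in> multichains r m. mon = (\<Sum>i<m. Poly_Mapping.single i (?d xs i))})"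
    unfolding F_approx_def sum_fun_apply mono_series_def
    by (simp add: finite_multichains Int_def flip: sum.inter_filter)
  also have "{xs \<in> multichains r m. mon = (\<Sum>i<m. Poly_Mapping.single i (?d xs i))} =
     (if Poly_Mapping.keys mon \<subseteq> {..<m} then rank_chains r (map (Poly_Mapping.lookup mon) [0..<m]) (pbot r) else {})"
    unfolding eq by (auto simp: multichains_def rank_chains_def)
  finally show ?thesis by (simp add: card_rank_chains split: if_splits)
qed

lemma comp_of_eq_filter:
  assumes "Poly_Mapping.keys mon \<subseteq> {..<m}"
  shows "filter (\<lambda>p. p \<noteq> 0) (map (Poly_Mapping.lookup mon) [0..<m]) = comp_of mon"
proof -
  let ?xs = "filter (\<lambda>i. Poly_Mapping.lookup mon i \<noteq> 0) [0..<m]"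
  have "set ?xs = Poly_Mapping.keys mon"
    using assms by (auto simp: in_keys_iff)
  moreover have "sorted ?xs" "distinct ?xs" by (simp_all add: sorted_wrt_filter)
  ultimately have "?xs = sorted_list_of_set (Poly_Mapping.keys mon)"
    by (metis sorted_list_of_set.idem_if_sorted_distinct)
  then show ?thesis by (simp add: comp_of_def filter_map o_def)
qed

text \<open>The limit defining \<open>F_QSym r\<close> exists and is unique.\<close>

lemma F_approx_limit:
  "limitin (product_topology (\<lambda>_. discrete_topology UNIV) UNIV) (F_approx r) (f :: 'k::field series) sequentially
     \<longleftrightarrow> (\<forall>mon. f mon = of_nat (chain_count r (comp_of mon) (pbot r)))"
proof -
  let ?c = "\<lambda>mon. of_nat (chain_count r (comp_of mon) (pbot r)) :: 'k"
  have ev: "eventually (\<lambda>m. F_approx r m mon = ?c mon) sequentially" for mon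
  proof -
    obtain N where N: "Poly_Mapping.keys mon \<subseteq> {..<N}"
      using finite_nat_bounded[OF finite_keys] by blast
    show ?thesis
    proof (rule eventually_sequentiallyI)
      fix m assume "N \<le> m"
      then have keys: "Poly_Mapping.keys mon \<subseteq> {..<m}" using N by auto
      have "pbot r \<in> Field r" using is_bot_pbot[OF g] by (simp add: is_bot_def)
      from chain_count_filter[OF this] show "F_approx r m mon = ?c mon"
        unfolding F_approx_apply using keys comp_of_eq_filter[OF keys] by metis
    qed
  qed
  have "limitin (discrete_topology UNIV) (\<lambda>m. F_approx r m mon) c sequentially \<longleftrightarrow> c = ?c mon" for mon c
  proof
    assume "limitin (discrete_topology UNIV) (\<lambda>m. F_approx r m mon) c sequentially"
    then have "eventually (\<lambda>m. F_approx r m mon \<in> {c}) sequentially"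
      by (rule limitinD) auto
    then have "eventually (\<lambda>_::nat. c = ?c mon) sequentially"
      using ev[of mon] by eventually_elim simp
    then show "c = ?c mon" by simp
  next
    assume "c = ?c mon"
    then show "limitin (discrete_topology UNIV) (\<lambda>m. F_approx r m mon) c sequentially"
      using ev by (intro limitin_eventually) auto
  qed
  then show ?thesis
    unfolding limitin_componentwise by simp
qed

lemma F_QSym_limit:
  "limitin (product_topology (\<lambda>_. discrete_topology UNIV) UNIV) (F_approx r)
     (F_QSym r :: 'k::field series) sequentially"
  unfolding F_QSym_def by (rule theI'[of "\<lambda>f. limitin _ _ f _"])
    (auto simp: F_approx_limit fun_eq_iff intro!: ex1I[of _ "\<lambda>mon. of_nat (chain_count r (comp_of mon) (pbot r))"])

lemma F_QSym_apply: "F_QSym r mon = of_nat (chain_count r (comp_of mon) (pbot r))"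
  using F_QSym_limit unfolding F_approx_limit by blast

lemma comp_of_in_compositions: "comp_of mon \<in> compositions"
  by (auto simp: comp_of_def compositions_def in_keys_iff)

lemma finite_compositions: "finite {\<alpha> \<in> compositions. sum_list \<alpha> \<le> N}"
proof (rule finite_subset)
  show "{\<alpha> \<in> compositions. sum_list \<alpha> \<le> N} \<subseteq> {\<alpha>. set \<alpha> \<subseteq> {..N} \<and> length \<alpha> \<le> N}"
  proof clarify
    fix \<alpha> assume \<alpha>: "\<alpha> \<in> compositions" "sum_list \<alpha> \<le> N"
    have "length \<alpha> \<le> sum_list \<alpha>"
      using \<alpha>(1) by (induction \<alpha>) (auto simp: compositions_def)
    then show "set \<alpha> \<subseteq> {..N} \<and> length \<alpha> \<le> N"
      using \<alpha>(2) member_le_sum_list by fastforce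
  qed
  show "finite {\<alpha>::nat list. set \<alpha> \<subseteq> {..N} \<and> length \<alpha> \<le> N}"
    by (rule finite_lists_length_le) simp
qed

lemma F_QSym_in_QSym: "(F_QSym r :: 'k::field series) \<in> QSym"
proof -
  let ?C = "{\<alpha> \<in> compositions. sum_list \<alpha> \<le> poset_rank r (ptop r)}"
  let ?c = "\<lambda>\<alpha>. of_nat (chain_count r \<alpha> (pbot r)) :: 'k"
  have "F_QSym r = (\<Sum>\<alpha>\<in>?C. fscale (?c \<alpha>) (M_QSym \<alpha>))"
  proof
    fix mon
    have "(\<Sum>\<alpha>\<in>?C. fscale (?c \<alpha>) (M_QSym \<alpha>)) mon = (\<Sum>\<alpha>\<in>?C. if comp_of mon = \<alpha> then ?c \<alpha> else 0)"
      unfolding sum_fun_apply by (rule sum.cong) (auto simp: fscale_def M_QSym_apply)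
    also have "\<dots> = (if comp_of mon \<in> ?C then ?c (comp_of mon) else 0)"
      using finite_compositions by simp
    also have "\<dots> = ?c (comp_of mon)"
    proof (cases "chain_count r (comp_of mon) (pbot r) = 0")
      case False
      then show ?thesis
        using chain_count_nonzero[OF False] comp_of_in_compositions[of mon] by simp
    qed simp
    finally show "F_QSym r mon = (\<Sum>\<alpha>\<in>?C. fscale (?c \<alpha>) (M_QSym \<alpha>)) mon"
      by (simp add: F_QSym_apply)
  qed
  then show ?thesis
    unfolding QSym_def by (simp only:) (intro fs.span_sum fs.span_scale fs.span_base, auto)
qed

end

lemma F_BQSym_in_BQSym:
  assumes g: "graded_poset r"
  shows "(F_BQSym r :: nat \<times> mono \<Rightarrow> 'k::field) \<in> BQSym"
  unfolding F_BQSym_def BQSym_def tensor_space_def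
proof (rule fs.span_sum, rule fs.span_base)
  fix x assume "x \<in> Field r - {pbot r}"
  then have "(x, ptop r) \<in> r" using is_top_ptop[OF g] by (auto simp: is_top_def)
  then have "F_QSym (poset_interval r x (ptop r)) \<in> (QSym :: 'k series set)"
    by (intro F_QSym_in_QSym graded_poset_interval(1)[OF g])
  moreover have "s_pow (poset_rank r x - 1) \<in> (polys_s :: (nat \<Rightarrow> 'k) set)"
    by (simp add: polys_s_def s_pow_def)
  ultimately show "s_pow (poset_rank r x - 1) \<otimes> F_QSym (poset_interval r x (ptop r))
      \<in> {f \<otimes> g |f g. f \<in> (polys_s :: (nat \<Rightarrow> 'k) set) \<and> g \<in> QSym}"
    by blast
qed

end

theory Submission
  imports Defs
begin

text \<open>
  The coefficient of \<open>M\<^sub>\<alpha>\<close> in \<open>F(P)\<close> is the number of chains from the minimal to the maximal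
  element of \<open>P\<close> whose successive rank increments are \<open>\<alpha>\<close>. Since the coproduct of \<open>QSym\<close>
  deconcatenates compositions, the coefficient of \<open>M\<^sub>\<alpha> \<otimes> M\<^sub>\<beta>\<close> in the coproduct of \<open>F(P)\<close> is the
  coefficient of the concatenation \<open>\<alpha>\<beta>\<close> in \<open>F(P)\<close> (\<open>delta_QSym_apply\<close>). A chain with increments
  \<open>\<alpha>\<beta>\<close> is cut by its element in position \<open>length \<alpha>\<close> into a chain with increments \<open>\<alpha>\<close> and
  one with increments \<open>\<beta>\<close> (\<open>chains_between_append\<close>). Summing over that element \<open>y\<close> gives
  \<open>\<Delta>(F([x, w])) = (\<Sum>x \<le> y \<le> w. F([x, y]) \<otimes> F([y, w]))\<close> (\<open>delta_QSym_F_QSym\<close>).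

  In type \<open>B\<close> the coproduct does not touch the powers of \<open>s\<close>, so applying this identity to each
  summand of \<open>F\<^sub>B(P)\<close> yields the sum of \<open>(s\<^bsup>\<rho>(x)-1\<^esup> \<otimes> F([x, y])) \<otimes> F([y, 1])\<close> over all pairs
  \<open>0 < x \<le> y\<close>, where \<open>0\<close> and \<open>1\<close> are the extreme elements of \<open>P\<close>. Collecting the terms with the
  same \<open>y\<close> makes the left factor \<open>F\<^sub>B([0, y])\<close>, because ranks in \<open>[0, y]\<close> are those of \<open>P\<close> and the
  intervals of \<open>[0, y]\<close> are intervals of \<open>P\<close>.
\<close>

text \<open>
  In contrast to \<open>chain_count\<close>, the upper end point is a parameter. This allows the counts for
  all intervals of a poset to be compared within that poset.
\<close>

primrec chains_between :: "'a rel \<Rightarrow> nat list \<Rightarrow> 'a \<Rightarrow> 'a \<Rightarrow> nat" where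
  "chains_between r [] x y = (if x = y then 1 else 0)"
| "chains_between r (p # ps) x y =
     (\<Sum>z | (x, z) \<in> r \<and> poset_rank r z - poset_rank r x = p. chains_between r ps z y)"

lemma chains_between_nonzero:
  assumes g: "graded_poset r" and x: "x \<in> Field r" and "chains_between r ps x y \<noteq> 0"
  shows "(x, y) \<in> r"
  using x assms(3)
proof (induction ps arbitrary: x)
  case Nil
  then show ?case using poset_refl[OF g] by (auto split: if_splits)
next
  case (Cons p ps)
  then have "(\<Sum>z | (x, z) \<in> r \<and> poset_rank r z - poset_rank r x = p. chains_between r ps z y) \<noteq> 0"
    by simp
  then obtain z where "(x, z) \<in> r" "chains_between r ps z y \<noteq> 0"
    by (rule sum.not_neutral_contains_not_neutral) blast
  then show ?case
    using Cons.IH poset_Field[OF g] poset_trans[OF g] by blast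
qed

lemma chain_count_poset_interval:
  assumes g: "graded_poset r" and "(x, z) \<in> r" "(z, y) \<in> r"
  shows "chain_count (poset_interval r x y) ps z = chains_between r ps z y"
  using assms(2,3)
proof (induction ps arbitrary: z)
  case Nil
  then show ?case
    using graded_poset_interval(4)[OF g poset_trans[OF g]] by simp
next
  case (Cons p ps)
  let ?I = "poset_interval r x y"
  have xy: "(x, y) \<in> r" using Cons.prems poset_trans[OF g] by blast
  have iff: "(z, w) \<in> ?I \<and> poset_rank ?I w - poset_rank ?I z = p \<longleftrightarrow>
      (z, w) \<in> r \<and> (w, y) \<in> r \<and> poset_rank r w - poset_rank r z = p" for w
  proof (cases "(z, w) \<in> r \<and> (w, y) \<in> r")
    case True
    then have xw: "(x, w) \<in> r" using Cons.prems poset_trans[OF g] by blast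
    then show ?thesis
      using True Cons.prems poset_rank_le[OF g] graded_poset_interval(5)[OF g xy]
      by (auto simp: poset_interval_def)
  qed (auto simp: poset_interval_def)
  have "chain_count ?I (p # ps) z =
      (\<Sum>w | (z, w) \<in> r \<and> (w, y) \<in> r \<and> poset_rank r w - poset_rank r z = p. chains_between r ps w y)"
    unfolding chain_count.simps iff
  proof (rule sum.cong)
    fix w assume "w \<in> {w. (z, w) \<in> r \<and> (w, y) \<in> r \<and> poset_rank r w - poset_rank r z = p}"
    then have w: "(z, w) \<in> r" "(w, y) \<in> r" by blast+
    show "chain_count ?I ps w = chains_between r ps w y"
      by (rule Cons.IH[OF poset_trans[OF g Cons.prems(1) w(1)] w(2)])
  qed simp
  \<comment> \<open>An element that is not below \<open>y\<close> starts no chain that ends at \<open>y\<close>.\<close>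
  also have "\<dots> = (\<Sum>w | (z, w) \<in> r \<and> poset_rank r w - poset_rank r z = p. chains_between r ps w y)"
  proof (rule sum.mono_neutral_left)
    show "\<forall>w\<in>{w. (z, w) \<in> r \<and> poset_rank r w - poset_rank r z = p} -
        {w. (z, w) \<in> r \<and> (w, y) \<in> r \<and> poset_rank r w - poset_rank r z = p}.
        chains_between r ps w y = 0"
      using chains_between_nonzero[OF g FieldI2] by fastforce
  qed (auto simp: up_finite[OF g])
  finally show ?case by simp
qed

lemma F_QSym_poset_interval:
  assumes "graded_poset r" "(x, y) \<in> r"
  shows "F_QSym (poset_interval r x y) m = of_nat (chains_between r (comp_of m) x y)"
proof -
  have "(x, x) \<in> r" using assms poset_refl poset_Field by metis
  with assms show ?thesis
    by (simp add: F_QSym_apply graded_poset_interval(1,3) chain_count_poset_interval)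
qed

text \<open>
  A chain is cut at the element \<open>y\<close> that it reaches after the increments \<open>ps\<close>.
\<close>

lemma chains_between_append:
  assumes g: "graded_poset r" and x: "x \<in> Field r"
  shows "chains_between r (ps @ qs) x w =
    (\<Sum>y\<in>Field r. chains_between r ps x y * chains_between r qs y w)"
  using x
proof (induction ps arbitrary: x)
  case Nil
  have "(\<Sum>y\<in>Field r. chains_between r [] x y * chains_between r qs y w) =
      (\<Sum>y\<in>Field r. if x = y then chains_between r qs y w else 0)"
    by (rule sum.cong) auto
  then show ?case using Nil poset_finite[OF g] by simp
next
  case (Cons p ps)
  let ?Z = "{z. (x, z) \<in> r \<and> poset_rank r z - poset_rank r x = p}"
  have "chains_between r ((p # ps) @ qs) x w =
      (\<Sum>z\<in>?Z. \<Sum>y\<in>Field r. chains_between r ps z y * chains_between r qs y w)"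
    unfolding append_Cons chains_between.simps
    by (rule sum.cong[OF refl], rule Cons.IH) (auto intro: FieldI2)
  also have "\<dots> = (\<Sum>y\<in>Field r. \<Sum>z\<in>?Z. chains_between r ps z y * chains_between r qs y w)"
    by (rule sum.swap)
  finally show ?case by (simp add: sum_distrib_right)
qed

text \<open>
  A composition arises from a pair of its prefix and the complementary suffix in exactly one way,
  so deconcatenation of \<open>M\<^sub>\<alpha>\<close> produces the term \<open>M\<^sub>\<beta> \<otimes> M\<^sub>\<gamma>\<close> once if \<open>\<alpha>\<close> is the concatenation of
  \<open>\<beta>\<close> and \<open>\<gamma>\<close>, and otherwise not at all.
\<close>

lemma delta_QSym_apply:
  assumes f: "f \<in> QSym" and m: "comp_of m = comp_of m1 @ comp_of m2"
  shows "delta_QSym f (m1, m2) = (f m :: 'k::field)"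
  using f unfolding QSym_def
proof (rule fs.span_induct)
  interpret D: Vector_Spaces.linear fscale fscale "delta_QSym :: 'k series \<Rightarrow> _"
    by (rule linear_delta_QSym)
  show "fs.subspace {f :: 'k series. delta_QSym f (m1, m2) = f m}"
    by (rule fs.subspaceI) (auto simp: D.add D.scale, auto simp: fscale_def)
next
  fix f :: "'k series" assume "f \<in> M_QSym ` compositions"
  then obtain \<alpha> where \<alpha>: "\<alpha> \<in> compositions" and f: "f = M_QSym \<alpha>" by blast
  have td: "take i \<alpha> \<in> compositions" "drop i \<alpha> \<in> compositions" for i
    using \<alpha> by (auto simp: compositions_def dest: in_set_takeD in_set_dropD)
  have "delta_QSym f (m1, m2) =
      (\<Sum>i\<le>length \<alpha>. if i = length (comp_of m1) then if \<alpha> = comp_of m then 1 else 0 else 0)"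
    unfolding f delta_QSym_M[OF \<alpha>] sum_fun_apply
  proof (rule sum.cong[OF refl])
    fix i assume "i \<in> {..length \<alpha>}"
    then have iff: "comp_of m1 = take i \<alpha> \<and> comp_of m2 = drop i \<alpha> \<longleftrightarrow>
        i = length (comp_of m1) \<and> \<alpha> = comp_of m"
      unfolding m by (auto simp: append_eq_conv_conj)
    have "(M_QSym (take i \<alpha>) \<otimes> M_QSym (drop i \<alpha>)) (m1, m2) =
        (if comp_of m1 = take i \<alpha> \<and> comp_of m2 = drop i \<alpha> then 1 else (0 :: 'k))"
      by (simp add: tensor_def M_QSym_apply td)
    then show "(M_QSym (take i \<alpha>) \<otimes> M_QSym (drop i \<alpha>)) (m1, m2) =
        (if i = length (comp_of m1) then if \<alpha> = comp_of m then 1 else 0 else (0 :: 'k))"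
      unfolding iff by simp
  qed
  also have "\<dots> = f m"
    by (auto simp: f M_QSym_apply \<alpha> m)
  finally show "delta_QSym f (m1, m2) = f m" .
qed

text \<open>
  In other words, \<open>[x, w] \<mapsto> F([x, w])\<close> is compatible with the coproduct of the incidence coalgebra
  of \<open>r\<close>. A coefficient of the left-hand side counts chains with concatenated increments, and
  cutting them gives the products of chain counts on the right-hand side.
\<close>

lemma delta_QSym_F_QSym:
  assumes g: "graded_poset r" and xw: "(x, w) \<in> r"
  shows "delta_QSym (F_QSym (poset_interval r x w) :: 'k::field series) =
    (\<Sum>y | (x, y) \<in> r \<and> (y, w) \<in> r. F_QSym (poset_interval r x y) \<otimes> F_QSym (poset_interval r y w))"
proof (rule ext, clarify)
  fix m1 m2
  let ?C = "\<lambda>m. chains_between r (comp_of m)"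
  have xF: "x \<in> Field r" using poset_Field[OF g xw] by blast
  have "comp_of m1 @ comp_of m2 \<in> compositions"
    using comp_of_in_compositions[OF g, of m1] comp_of_in_compositions[OF g, of m2]
    by (auto simp: compositions_def)
  then obtain m where m: "comp_of m = comp_of m1 @ comp_of m2"
    by (rule comp_of_exists)
  have "delta_QSym (F_QSym (poset_interval r x w) :: 'k series) (m1, m2) = of_nat (?C m x w)"
    using delta_QSym_apply[OF F_QSym_in_QSym[OF graded_poset_interval(1)[OF g xw]] m]
    by (simp add: F_QSym_poset_interval[OF g xw])
  also have "?C m x w = (\<Sum>y\<in>Field r. ?C m1 x y * ?C m2 y w)"
    unfolding m by (rule chains_between_append[OF g xF])
  also have "\<dots> = (\<Sum>y | (x, y) \<in> r \<and> (y, w) \<in> r. ?C m1 x y * ?C m2 y w)"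
  proof (rule sum.mono_neutral_right)
    show "\<forall>y\<in>Field r - {y. (x, y) \<in> r \<and> (y, w) \<in> r}. ?C m1 x y * ?C m2 y w = 0"
      using chains_between_nonzero[OF g xF] chains_between_nonzero[OF g] by fastforce
  qed (use poset_finite[OF g] poset_Field[OF g] in auto)
  finally show "delta_QSym (F_QSym (poset_interval r x w) :: 'k series) (m1, m2) =
    (\<Sum>y | (x, y) \<in> r \<and> (y, w) \<in> r.
       F_QSym (poset_interval r x y) \<otimes> F_QSym (poset_interval r y w)) (m1, m2)"
    by (simp add: sum_fun_apply tensor_def F_QSym_poset_interval[OF g])
qed

lemma poset_interval_poset_interval:
  assumes g: "graded_poset r" and "(a, x) \<in> r" "(y, b) \<in> r"
  shows "poset_interval (poset_interval r a b) x y = poset_interval r x y"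
proof -
  have "(a, z) \<in> r" if "(x, z) \<in> r" for z
    using poset_trans[OF g assms(2) that] .
  moreover have "(z, b) \<in> r" if "(z, y) \<in> r" for z
    using poset_trans[OF g that assms(3)] .
  moreover have "(x, b) \<in> r" "(a, y) \<in> r" if "(x, z) \<in> r" "(z, y) \<in> r" for z
    using calculation poset_trans[OF g that] by blast+
  moreover have "(x, x) \<in> r" "(y, y) \<in> r"
    using poset_refl[OF g] poset_Field[OF g] assms(2,3) by blast+
  ultimately show ?thesis
    unfolding poset_interval_def by (intro set_eqI) (simp split: prod.split, blast)
qed

lemma F_BQSym_lower_interval:
  assumes g: "graded_poset r" and y: "y \<in> Field r"
  shows "F_BQSym (poset_interval r (pbot r) y) =
    (\<Sum>x | x \<noteq> pbot r \<and> (x, y) \<in> r. s_pow (poset_rank r x - 1) \<otimes> F_QSym (poset_interval r x y))"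
proof -
  have bot: "(pbot r, x) \<in> r" if "x \<in> Field r" for x
    using is_bot_pbot[OF g] that by (auto simp: is_bot_def)
  have rank_bot: "poset_rank r (pbot r) = 0"
    using is_rank_poset_rank[OF g] is_bot_pbot[OF g] by (auto simp: is_rank_def)
  note I = graded_poset_interval[OF g bot[OF y]]
  show ?thesis
    unfolding F_BQSym_def I(2-4)
  proof (rule sum.cong)
    show "{z. (pbot r, z) \<in> r \<and> (z, y) \<in> r} - {pbot r} = {x. x \<noteq> pbot r \<and> (x, y) \<in> r}"
      using bot poset_Field[OF g] by blast
    fix x assume "x \<in> {x. x \<noteq> pbot r \<and> (x, y) \<in> r}"
    then have xy: "(pbot r, x) \<in> r" "(x, y) \<in> r" using bot poset_Field[OF g] by blast+
    then show "s_pow (poset_rank (poset_interval r (pbot r) y) x - 1) \<otimes>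
          F_QSym (poset_interval (poset_interval r (pbot r) y) x y) =
        s_pow (poset_rank r x - 1) \<otimes> F_QSym (poset_interval r x y)"
      by (simp add: I(5)[OF xy] rank_bot
          poset_interval_poset_interval[OF g xy(1) poset_refl[OF g y]])
  qed
qed

theorem theorem13p6:
  fixes r :: "'a rel"
  assumes "graded_poset r"
  shows "delta_BQSym (F_BQSym r :: nat \<times> mono \<Rightarrow> 'k::field) =
    (\<Sum>x \<in> Field r - {pbot r}. F_BQSym (poset_interval r (pbot r) x) \<otimes> F_QSym (poset_interval r x (ptop r)))"
proof -
  note g = assms
  let ?X = "Field r - {pbot r}"
  let ?s = "\<lambda>x. s_pow (poset_rank r x - 1) :: nat \<Rightarrow> 'k"
  let ?F = "\<lambda>x y. F_QSym (poset_interval r x y) :: 'k series"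
  interpret D: Vector_Spaces.linear fscale fscale "delta_BQSym :: (nat \<times> mono \<Rightarrow> 'k) \<Rightarrow> _"
    by (rule linear_delta_BQSym)
  interpret A: Vector_Spaces.linear fscale fscale
    "tensor_assoc :: (nat \<times> mono \<times> mono \<Rightarrow> 'k) \<Rightarrow> _"
    by (rule linear_tensor_assoc)
  have top: "(x, ptop r) \<in> r" if "x \<in> Field r" for x
    using is_top_ptop[OF g] that by (auto simp: is_top_def)
  have bot: "(pbot r, x) \<in> r" if "x \<in> Field r" for x
    using is_bot_pbot[OF g] that by (auto simp: is_bot_def)
  have summand: "delta_BQSym (?s x \<otimes> ?F x (ptop r)) =
      (\<Sum>y | y \<in> ?X \<and> (x, y) \<in> r. (?s x \<otimes> ?F x y) \<otimes> ?F y (ptop r))" if x: "x \<in> ?X" for x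
  proof -
    interpret S: Vector_Spaces.linear fscale fscale "\<lambda>h :: mono \<times> mono \<Rightarrow> 'k. ?s x \<otimes> h"
      by (rule linear_tensor_right)
    have xt: "(x, ptop r) \<in> r" using top x by blast
    have "delta_BQSym (?s x \<otimes> ?F x (ptop r)) = tensor_assoc (?s x \<otimes> delta_QSym (?F x (ptop r)))"
      by (rule delta_BQSym_tensor[OF F_QSym_in_QSym[OF graded_poset_interval(1)[OF g xt]]])
    also have "\<dots> = (\<Sum>y | (x, y) \<in> r \<and> (y, ptop r) \<in> r. (?s x \<otimes> ?F x y) \<otimes> ?F y (ptop r))"
      unfolding delta_QSym_F_QSym[OF g xt] S.sum A.sum tensor_assoc_tensor ..
    \<comment> \<open>Only the minimal element lies below the minimal element, so \<open>y \<ge> x\<close> cannot be minimal.\<close>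
    also have "{y. (x, y) \<in> r \<and> (y, ptop r) \<in> r} = {y. y \<in> ?X \<and> (x, y) \<in> r}"
      using x top bot poset_Field[OF g] poset_antisym[OF g] by blast
    finally show ?thesis .
  qed
  have "delta_BQSym (F_BQSym r :: nat \<times> mono \<Rightarrow> 'k) =
      (\<Sum>x\<in>?X. \<Sum>y | y \<in> ?X \<and> (x, y) \<in> r. (?s x \<otimes> ?F x y) \<otimes> ?F y (ptop r))"
    unfolding F_BQSym_def D.sum by (rule sum.cong[OF refl summand])
  also have "\<dots> = (\<Sum>y\<in>?X. \<Sum>x | x \<in> ?X \<and> (x, y) \<in> r. (?s x \<otimes> ?F x y) \<otimes> ?F y (ptop r))"
    by (rule sum.swap_restrict) (simp_all add: poset_finite[OF g])
  also have "\<dots> = (\<Sum>y\<in>?X. F_BQSym (poset_interval r (pbot r) y) \<otimes> ?F y (ptop r))"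
  proof (rule sum.cong[OF refl])
    fix y assume y: "y \<in> ?X"
    interpret L: Vector_Spaces.linear fscale fscale "\<lambda>f :: nat \<times> mono \<Rightarrow> 'k. f \<otimes> ?F y (ptop r)"
      by (rule linear_tensor_left)
    have "{x. x \<noteq> pbot r \<and> (x, y) \<in> r} = {x. x \<in> ?X \<and> (x, y) \<in> r}"
      using poset_Field[OF g] by blast
    with F_BQSym_lower_interval[OF g, of y, where ?'b = 'k] y
    have "F_BQSym (poset_interval r (pbot r) y) = (\<Sum>x | x \<in> ?X \<and> (x, y) \<in> r. ?s x \<otimes> ?F x y)"
      by (simp only: Diff_iff)
    then show "(\<Sum>x | x \<in> ?X \<and> (x, y) \<in> r. (?s x \<otimes> ?F x y) \<otimes> ?F y (ptop r)) =
        F_BQSym (poset_interval r (pbot r) y) \<otimes> ?F y (ptop r)"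
      by (simp only: L.sum)
  qed
  finally show ?thesis .
qed

end
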